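(* Let $I\subseteq\mathbb{R}$ be an interval with interior $I^{\circ}$, let $f:I\to\mathbb{R}$ be differentiable on $I^{\circ}$ and such that $f'\in L[a,b]$, where $a,b\in I$ with $a<b$. Let $p>1$ be fixed and put $q=\frac{p}{p-1}$. If $|f'|^{\frac{p}{p-1}}$ is convex on $[a,b]$, then for each $x\in[a,b]$, $$\left|\frac{(b-x)f(b)+(x-a)f(a)}{b-a}-\frac{1}{b-a}\int_a^b f(u)\,du\right|\le \left(\frac{1}{p+1}\right)^{\frac1p}\left(\frac12\right)^{\frac1q}\left[\frac{(x-a)^2\left[|f'(a)|^q+|f'(x)|^q\right]^{\frac1q}+(b-x)^2\left[|f'(x)|^q+|f'(b)|^q\right]^{\frac1q}}{b-a}\right].$$
   Context: $f'\in L[a,b]$ means that $f'$ is (Lebesgue) integrable on $[a,b]$. *)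

theory Defs
  imports "HOL-Analysis.Analysis"
begin

end

theory Submission
  imports Defs
begin

text \<open>Integrating \<open>((u - x) f(u))' = f(u) + (u - x) f'(u)\<close> turns the left-hand side into
  \<open>\<bar>\<integral> (u - x) f'(u) du\<bar> / (b - a)\<close>. On each of \<open>[a,x]\<close> and \<open>[x,b]\<close>, Hoelder's inequality separates
  \<open>\<bar>u - x\<bar>\<close> from \<open>\<bar>f'\<bar>\<close>, and convexity bounds \<open>\<bar>f'\<bar>\<^sup>q\<close> by its chord.\<close>

text \<open>Young's inequality is applied pointwise to the normalized factors and then integrated.
  Bounding \<open>t powr q\<close> by a function \<open>L\<close> with known integral suits a convex
  function under its chord: only the chord has to be integrated.\<close>

lemma Holder_integral_majorant:
  fixes \<phi> s t L :: "real \<Rightarrow> real" and p q :: real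
  assumes p: "p > 1" and q: "q > 1" and pq: "1 / p + 1 / q = 1"
    and \<phi>: "(\<phi> has_integral J) S"
    and \<phi>_le: "\<And>u. u \<in> S \<Longrightarrow> \<bar>\<phi> u\<bar> \<le> s u * t u"
    and s: "\<And>u. u \<in> S \<Longrightarrow> 0 \<le> s u" and t: "\<And>u. u \<in> S \<Longrightarrow> 0 \<le> t u"
    and A: "((\<lambda>u. s u powr p) has_integral A) S"
    and L: "(L has_integral B) S" and tL: "\<And>u. u \<in> S \<Longrightarrow> t u powr q \<le> L u"
  shows "\<bar>J\<bar> \<le> A powr (1 / p) * B powr (1 / q)"
proof -
  have A0: "0 \<le> A" using A by (rule has_integral_nonneg) simp
  have B0: "0 \<le> B" using L by (rule has_integral_nonneg) (meson order_trans powr_ge_zero tL)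
  \<comment> \<open>Perturbing by \<open>e\<close> allows normalizing by \<open>A\<close> and \<open>B\<close> even if one of them vanishes.\<close>
  have bound: "\<bar>J\<bar> \<le> (A + e) powr (1 / p) * (B + e) powr (1 / q)" if e: "e > 0" for e
  proof -
    define C where "C = (A + e) powr (1 / p) * (B + e) powr (1 / q)"
    have C0: "0 \<le> C" by (simp add: C_def)
    \<comment> \<open>\<open>?m\<close> is the bound from Young's inequality with
      \<open>t u powr q\<close> already replaced by \<open>L u\<close>. Its integral is at most
      \<open>C * (1 / p + 1 / q) = C\<close>, since \<open>A / (A + e)\<close> and
      \<open>B / (B + e)\<close> do not exceed 1.\<close>
    let ?m = "\<lambda>u. C * (1 / p * (s u powr p / (A + e)) + 1 / q * (L u / (B + e)))"
    have m: "(?m has_integral C * (1 / p * (A / (A + e)) + 1 / q * (B / (B + e)))) S"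
      by (intro has_integral_mult_right has_integral_add has_integral_divide A L)
    have le: "\<bar>\<phi> u\<bar> \<le> ?m u" if u: "u \<in> S" for u
    proof -
      let ?\<alpha> = "(A + e) powr (1 / p)" and ?\<beta> = "(B + e) powr (1 / q)"
      have "s u * t u = C * ((s u / ?\<alpha>) * (t u / ?\<beta>))"
        using A0 B0 e by (simp add: C_def)
      also have "\<dots> \<le> C * ((s u / ?\<alpha>) powr p / p + (t u / ?\<beta>) powr q / q)"
        using p q pq s[OF u] t[OF u] by (intro mult_left_mono C0 Youngs_inequality) auto
      also have "\<dots> = C * (1 / p * (s u powr p / (A + e)) + 1 / q * (t u powr q / (B + e)))"
        using A0 B0 e p q s[OF u] t[OF u] by (simp add: powr_divide powr_powr mult.commute)
      also have "\<dots> \<le> ?m u"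
        using B0 e q tL[OF u] by (intro mult_left_mono C0 add_left_mono divide_right_mono) auto
      finally show ?thesis using \<phi>_le[OF u] by linarith
    qed
    have "J \<le> C * (1 / p * (A / (A + e)) + 1 / q * (B / (B + e)))"
      using \<phi> m by (rule has_integral_le) (use le in \<open>force simp: abs_le_iff\<close>)
    moreover have "- J \<le> C * (1 / p * (A / (A + e)) + 1 / q * (B / (B + e)))"
      using has_integral_neg[OF \<phi>] m by (rule has_integral_le) (use le in \<open>force simp: abs_le_iff\<close>)
    moreover have "C * (1 / p * (A / (A + e)) + 1 / q * (B / (B + e))) \<le> C * (1 / p * 1 + 1 / q * 1)"
      using A0 B0 e p q by (intro mult_left_mono C0 add_mono) auto
    ultimately show ?thesis using pq by (simp add: C_def)
  qed
  \<comment> \<open>Let \<open>e\<close> tend to 0 from the right. The bases then stay nonnegative,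
    and the exponents are positive, so \<open>powr\<close> is continuous here even when
    \<open>A\<close> or \<open>B\<close> is 0.\<close>
  have "((\<lambda>e. (A + e) powr (1 / p) * (B + e) powr (1 / q)) \<longlongrightarrow>
      (A + 0) powr (1 / p) * (B + 0) powr (1 / q)) (at_right 0)"
    using A0 B0 p q
    by (intro tendsto_mult tendsto_powr' tendsto_intros)
       (auto intro!: eventually_at_rightI[of 0 1])
  then show ?thesis
    using bound by (intro tendsto_lowerbound[where F = "at_right 0"])
      (auto intro!: eventually_at_rightI[of 0 1])
qed

text \<open>This is one half of the estimate, with the dividing point \<open>x\<close> moved to 0,
  where the weight \<open>v\<close> vanishes. Hoelder's inequality is used with the weight
  \<open>v\<close> and the factor \<open>\<bar>G v\<bar>\<close>, whose power lies below its
  chord.\<close>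

lemma endpoint_rule_error:
  fixes F G :: "real \<Rightarrow> real" and p q h :: real
  assumes p: "p > 1" and q: "q > 1" and pq: "1 / p + 1 / q = 1" and h: "0 \<le> h"
    and der: "\<And>v. v \<in> {0..h} \<Longrightarrow> (F has_real_derivative G v) (at v within {0..h})"
    and conv: "convex_on {0..h} (\<lambda>v. \<bar>G v\<bar> powr q)"
  shows "\<bar>h * F h - integral {0..h} F\<bar> \<le>
    (1 / (p + 1)) powr (1 / p) * (1 / 2) powr (1 / q) *
      (h\<^sup>2 * (\<bar>G 0\<bar> powr q + \<bar>G h\<bar> powr q) powr (1 / q))"
proof (cases "h = 0")
  case False
  with h have h: "h > 0" by simp
  let ?g0 = "\<bar>G 0\<bar> powr q" and ?g1 = "\<bar>G h\<bar> powr q"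
  have "continuous_on {0..h} F"
    by (rule DERIV_continuous_on[OF der])
  then have F: "(F has_integral integral {0..h} F) {0..h}"
    by (intro integrable_integral integrable_continuous_real)
  \<comment> \<open>The integrand is the derivative of \<open>v * F v\<close>, so the fundamental
    theorem gives its integral; subtracting that of \<open>F\<close> leaves the integral of
    \<open>v * G v\<close>.\<close>
  have "((\<lambda>v. F v + v * G v) has_integral h * F h - 0 * F 0) {0..h}"
  proof (rule fundamental_theorem_of_calculus)
    fix v assume "v \<in> {0..h}"
    then show "((\<lambda>v. v * F v) has_vector_derivative F v + v * G v) (at v within {0..h})"
      unfolding has_real_derivative_iff_has_vector_derivative[symmetric]
      by (auto intro!: derivative_eq_intros der)
  qed (use h in simp)
  from has_integral_diff[OF this F]
  have J: "((\<lambda>v. v * G v) has_integral h * F h - integral {0..h} F) {0..h}" by simp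
  have w: "((\<lambda>v. v powr p) has_integral h powr (p + 1) / (p + 1)) {0..h}"
    using has_integral_powr_from_0[of p h] p h by simp
  \<comment> \<open>The chord of \<open>\<bar>G v\<bar> powr q\<close> is integrated by an explicit
    antiderivative. The result, \<open>h\<close> times the mean of the endpoint values, is the
    source of the factor \<open>1 / 2\<close>.\<close>
  have "((\<lambda>v. ?g0 + v * ((?g1 - ?g0) / h)) has_integral
      (h * ?g0 + h\<^sup>2 / 2 * ((?g1 - ?g0) / h)) - (0 * ?g0 + 0\<^sup>2 / 2 * ((?g1 - ?g0) / h))) {0..h}"
  proof (rule fundamental_theorem_of_calculus)
    fix v
    show "((\<lambda>v. v * ?g0 + v\<^sup>2 / 2 * ((?g1 - ?g0) / h)) has_vector_derivative
        ?g0 + v * ((?g1 - ?g0) / h)) (at v within {0..h})"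
      unfolding has_real_derivative_iff_has_vector_derivative[symmetric]
      by (rule derivative_eq_intros refl | simp)+
  qed (use h in simp)
  moreover have "(h * ?g0 + h\<^sup>2 / 2 * ((?g1 - ?g0) / h)) - (0 * ?g0 + 0\<^sup>2 / 2 * ((?g1 - ?g0) / h))
      = h * (1 / 2) * (?g0 + ?g1)"
    using h by (simp add: field_simps power2_eq_square)
  ultimately have chord:
    "((\<lambda>v. ?g0 + v * ((?g1 - ?g0) / h)) has_integral h * (1 / 2) * (?g0 + ?g1)) {0..h}"
    by (simp only:)
  \<comment> \<open>Here \<open>v\<close> is the convex combination of 0 and \<open>h\<close> with
    weight \<open>v / h\<close> on \<open>h\<close>.\<close>
  have chord_le: "\<bar>G v\<bar> powr q \<le> ?g0 + v * ((?g1 - ?g0) / h)" if "v \<in> {0..h}" for v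
    using convex_onD[OF conv, of "v / h" 0 h] that h by (simp add: field_simps)
  \<comment> \<open>Unification with \<open>w\<close> makes \<open>s\<close> the identity, and
    \<open>chord\<close> supplies \<open>L\<close>. The integral of \<open>v powr p\<close> is the
    source of the factor \<open>1 / (p + 1)\<close>.\<close>
  have "\<bar>h * F h - integral {0..h} F\<bar> \<le>
      (h powr (p + 1) / (p + 1)) powr (1 / p) * (h * (1 / 2) * (?g0 + ?g1)) powr (1 / q)"
    by (rule Holder_integral_majorant[OF p q pq J _ _ _ w chord, where t = "\<lambda>v. \<bar>G v\<bar>"])
       (use chord_le in \<open>auto simp: abs_mult\<close>)
  also have "\<dots> = (1 / (p + 1)) powr (1 / p) * (1 / 2) powr (1 / q) *
      ((h powr ((p + 1) / p) * h powr (1 / q)) * (?g0 + ?g1) powr (1 / q))"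
    using p h by (simp add: powr_divide powr_mult powr_powr)
  \<comment> \<open>The exponents add up to \<open>1 + 1 / p + 1 / q\<close>, which is 2 for
    conjugate \<open>p\<close> and \<open>q\<close>.\<close>
  also have "h powr ((p + 1) / p) * h powr (1 / q) = h powr 2"
  proof -
    have "(p + 1) / p + 1 / q = 2" using pq p by (simp add: add_divide_distrib)
    then show ?thesis by (simp flip: powr_add)
  qed
  also have "\<dots> = h\<^sup>2" using h by simp
  finally show ?thesis .
qed simp

text \<open>The bound evaluates \<open>f'\<close> at \<open>a\<close> and \<open>b\<close>, which
  may be endpoints of \<open>I\<close>; the derivative there is therefore taken within
  \<open>I\<close>, hence one-sided at an endpoint.\<close>

theorem theorem4:
  fixes I :: "real set" and f f' :: "real \<Rightarrow> real" and a b p q x :: real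
  assumes "is_interval I"
    and "\<And>u. u \<in> interior I \<Longrightarrow> (f has_real_derivative f' u) (at u)"
    and "\<And>u. u \<in> {a, b} \<Longrightarrow> (f has_real_derivative f' u) (at u within I)"
    and "a \<in> I" and "b \<in> I" and "a < b"
    and "f' absolutely_integrable_on {a..b}"
    and "p > 1" and "q = p / (p - 1)"
    and "convex_on {a..b} (\<lambda>u. \<bar>f' u\<bar> powr (p / (p - 1)))"
    and "x \<in> {a..b}"
  shows "\<bar>((b - x) * f b + (x - a) * f a) / (b - a) - 1 / (b - a) * integral {a..b} f\<bar>
    \<le> (1 / (p + 1)) powr (1 / p) * (1 / 2) powr (1 / q) *
      (((x - a)\<^sup>2 * (\<bar>f' a\<bar> powr q + \<bar>f' x\<bar> powr q) powr (1 / q)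
        + (b - x)\<^sup>2 * (\<bar>f' x\<bar> powr q + \<bar>f' b\<bar> powr q) powr (1 / q)) / (b - a))"
proof -
  note der_in = assms(2) and der_end = assms(3) and ab = \<open>a < b\<close> and p = \<open>p > 1\<close>
    and q = \<open>q = p / (p - 1)\<close>
  have q1: "q > 1" and pq: "1 / p + 1 / q = 1" using p unfolding q by (auto simp: divide_simps)
  have conv: "convex_on {a..b} (\<lambda>u. \<bar>f' u\<bar> powr q)" using assms(10) q by simp
  have sub: "{a..b} \<subseteq> I"
    using assms(1) \<open>a \<in> I\<close> \<open>b \<in> I\<close> by (meson atLeastAtMost_iff mem_is_interval_1_I subsetI)
  have der: "(f has_real_derivative f' u) (at u within {a..b})" if "u \<in> {a..b}" for u
  proof (cases "u \<in> {a, b}")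
    case True
    then show ?thesis using der_end sub by (blast intro: DERIV_subset)
  next
    case False
    moreover have "{a<..<b} \<subseteq> interior I"
      using sub by (intro interior_maximal) auto
    ultimately have "u \<in> interior I" using that by auto
    then show ?thesis by (rule has_field_derivative_at_within[OF der_in])
  qed
  define K where "K = (1 / (p + 1)) powr (1 / p) * (1 / 2) powr (1 / q)"
  \<comment> \<open>The sign \<open>\<sigma>\<close> is the direction in which one leaves
    \<open>x\<close>: 1 gives \<open>{x..b}\<close> and -1 gives \<open>{a..x}\<close> reflected.
    The chain rule contributes a factor \<open>\<sigma>\<close>, which the absolute values
    remove.\<close>
  have half: "\<bar>h * f (x + \<sigma> * h) - integral {0..h} (\<lambda>v. f (x + \<sigma> * v))\<bar> \<le>
      K * (h\<^sup>2 * (\<bar>f' x\<bar> powr q + \<bar>f' (x + \<sigma> * h)\<bar> powr q) powr (1 / q))"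
    if h: "0 \<le> h" and \<sigma>: "\<bar>\<sigma>\<bar> = 1" and range: "\<And>v. v \<in> {0..h} \<Longrightarrow> x + \<sigma> * v \<in> {a..b}" for h \<sigma>
  proof -
    have "\<bar>h * f (x + \<sigma> * h) - integral {0..h} (\<lambda>v. f (x + \<sigma> * v))\<bar> \<le> (1 / (p + 1)) powr (1 / p) *
      (1 / 2) powr (1 / q) * (h\<^sup>2 * (\<bar>\<sigma> * f' (x + \<sigma> * 0)\<bar> powr q + \<bar>\<sigma> * f' (x + \<sigma> * h)\<bar> powr q) powr (1 / q))"
    proof (rule endpoint_rule_error[OF p q1 pq h])
      fix v assume v: "v \<in> {0..h}"
      have "((\<lambda>v. x + \<sigma> * v) has_real_derivative \<sigma>) (at v within {0..h})"
        by (auto intro!: derivative_eq_intros)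
      moreover have "(f has_real_derivative f' (x + \<sigma> * v)) (at (x + \<sigma> * v) within (\<lambda>v. x + \<sigma> * v) ` {0..h})"
        using range v by (intro DERIV_subset[OF der]) auto
      ultimately show "((\<lambda>v. f (x + \<sigma> * v)) has_real_derivative \<sigma> * f' (x + \<sigma> * v)) (at v within {0..h})"
        using DERIV_image_chain[of f "f' (x + \<sigma> * v)" "\<lambda>v. x + \<sigma> * v" v "{0..h}" \<sigma>]
        by (simp add: o_def mult.commute[of \<sigma> "f' _"])
    next
      show "convex_on {0..h} (\<lambda>v. \<bar>\<sigma> * f' (x + \<sigma> * v)\<bar> powr q)"
      proof (rule convex_onI)
        fix t y z :: real assume "0 < t" "t < 1" and yz: "y \<in> {0..h}" "z \<in> {0..h}"
        \<comment> \<open>Affine maps preserve convex combinations, so convexity carries over to the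
          shifted or reflected function.\<close>
        moreover have "x + \<sigma> * ((1 - t) * y + t * z) = (1 - t) * (x + \<sigma> * y) + t * (x + \<sigma> * z)"
          by algebra
        ultimately show "\<bar>\<sigma> * f' (x + \<sigma> * ((1 - t) *\<^sub>R y + t *\<^sub>R z))\<bar> powr q
            \<le> (1 - t) * \<bar>\<sigma> * f' (x + \<sigma> * y)\<bar> powr q + t * \<bar>\<sigma> * f' (x + \<sigma> * z)\<bar> powr q"
          using convex_onD[OF conv _ _ range[OF yz(1)] range[OF yz(2)], of t] \<sigma>
          by (simp add: abs_mult)
      qed simp
    qed
    then show ?thesis using \<sigma> by (simp add: K_def abs_mult)
  qed
  have x: "a \<le> x" "x \<le> b" using assms(11) by auto
  have fint: "f integrable_on {a..b}"
    by (intro integrable_continuous_real DERIV_continuous_on[OF der])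
  have fx: "(f has_integral integral {x..b} f) {x..b}" "(f has_integral integral {a..x} f) {a..x}"
    using x by (auto intro!: integrable_integral integrable_subinterval_real[OF fint])
  \<comment> \<open>The integrals over \<open>{0..h}\<close> are carried back by a translation on
    the right of \<open>x\<close> and a reflection on the left; both scale by a factor of absolute
    value 1.\<close>
  have "(\<lambda>u. u - x) ` {x..b} = {0..b - x}"
    using x by (simp add: image_minus_const_atLeastAtMost')
  then have right: "integral {0..b - x} (\<lambda>v. f (x + v)) = integral {x..b} f"
    using has_integral_affinity[of f _ x b 1 x] fx(1) by (auto intro: integral_unique simp: add.commute)
  have "(\<lambda>u. x - u) ` {a..x} = {0..x - a}"
    using x by simp
  then have left: "integral {0..x - a} (\<lambda>v. f (x - v)) = integral {a..x} f"
    using has_integral_affinity[of f _ a x "- 1" x] fx(2) by (auto intro: integral_unique simp: add.commute)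
  have split: "integral {a..x} f + integral {x..b} f = integral {a..b} f"
    using x fint by (rule Henstock_Kurzweil_Integration.integral_combine)
  have "\<bar>(b - x) * f b - integral {x..b} f\<bar> \<le> K * ((b - x)\<^sup>2 * (\<bar>f' x\<bar> powr q + \<bar>f' b\<bar> powr q) powr (1 / q))"
    using half[of "b - x" 1] x right by simp
  moreover have "\<bar>(x - a) * f a - integral {a..x} f\<bar> \<le> K * ((x - a)\<^sup>2 * (\<bar>f' a\<bar> powr q + \<bar>f' x\<bar> powr q) powr (1 / q))"
    using half[of "x - a" "- 1"] x left by (simp add: add.commute)
  ultimately have "\<bar>(b - x) * f b + (x - a) * f a - integral {a..b} f\<bar> \<le>
      K * ((x - a)\<^sup>2 * (\<bar>f' a\<bar> powr q + \<bar>f' x\<bar> powr q) powr (1 / q)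
        + (b - x)\<^sup>2 * (\<bar>f' x\<bar> powr q + \<bar>f' b\<bar> powr q) powr (1 / q))"
    \<comment> \<open>The error on \<open>{a..b}\<close> is the sum of the errors on the two halves,
      so the triangle inequality suffices.\<close>
    unfolding split[symmetric] distrib_left by linarith
  then have "\<bar>(b - x) * f b + (x - a) * f a - integral {a..b} f\<bar> / (b - a) \<le>
      K * ((x - a)\<^sup>2 * (\<bar>f' a\<bar> powr q + \<bar>f' x\<bar> powr q) powr (1 / q)
        + (b - x)\<^sup>2 * (\<bar>f' x\<bar> powr q + \<bar>f' b\<bar> powr q) powr (1 / q)) / (b - a)"
    using ab by (intro divide_right_mono) auto
  moreover have "((b - x) * f b + (x - a) * f a) / (b - a) - 1 / (b - a) * integral {a..b} f
      = ((b - x) * f b + (x - a) * f a - integral {a..b} f) / (b - a)"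
    by (simp add: diff_divide_distrib)
  ultimately show ?thesis
    using ab by (simp add: K_def abs_divide)
qed

end
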